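(* Let $1\le p\le\infty$ and let $X$ be a Banach space. Suppose there exist a Banach space $Z$ and a non-compact $T\in B(Z,X)$ such that $T^*\in\Pi_p(X^*,Z^* )$. Then each of the lattices $\mathrm{FBL}^{(p)}[X]$, $\overline{I}_{w^*}^{p}[X]$, $H_{w^*}^{p}[X]$ fails the $\lambda$-Fatou property, for every $\lambda>0$. If, moreover, $T$ has a sequential finite dimensional resolution (SFDR), then each of these lattices fails the countable $\lambda$-Fatou property, for every $\lambda>0$.
   Context: All Banach spaces are real. $B(Z,X)$ is the space of bounded linear operators; $\Pi_p$ is the ideal of $p$-summing operators (for $p=\infty$, all bounded operators). Let $1/p+1/p'=1$. For $z_1,\dots,z_n$ in a Banach space, $\|(z_i)_{i=1}^n\|_{p,\mathrm{weak}}=\sup\{\|\sum_i\alpha_i z_i\| : \|(\alpha_i)_i\|_{\ell_{p'}}\le 1\}$. For a Banach space $X$, $H_{w^*}[X]$ is the vector lattice (pointwise operations and order) of positively homogeneous functions $f:X^*\to\mathbb R$ that are weak$^*$-continuous on bounded sets. For $f\in H_{w^*}[X]$, $\|f\|_p$ is the infimum of all $C\ge 0$ such that $(\sum_{i=1}^n|f(x_i^* )|^p)^{1/p}\le C\|(x_i^* )_{i=1}^n\|_{p,\mathrm{weak}}$ for all $n$ and all $x_1^*,\dots,x_n^*\in X^*$ (for $p=\infty$ this is the sup norm over the unit ball of $X^*$). $H_{w^*}^p[X]=\{f\in H_{w^*}[X]:\|f\|_p<\infty\}$, normed by $\|\cdot\|_p$. For $x\in X$, $\delta_x(x^* )=\langle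 x^*,x\rangle$. $\mathrm{FVL}[X]$ is the vector sublattice of $H_{w^*}[X]$ generated by $\{\delta_x:x\in X\}$; $\mathrm{FBL}^{(p)}[X]$ is the closure of $\mathrm{FVL}[X]$ in $H_{w^*}^p[X]$; $I_{w^*}[X]$ is the (order) ideal of $H_{w^*}[X]$ generated by $\{\delta_x:x\in X\}$; $\overline{I}_{w^*}^p[X]$ is the closure of $I_{w^*}[X]$ in $H_{w^*}^p[X]$. A Banach lattice $Z$ has the $\lambda$-Fatou property if for every upward directed set $\mathcal S\subset Z_+$ having a supremum $z_0$ in $Z$, one has $\|z_0\|\le\lambda\sup_{z\in\mathcal S}\|z\|$; the countable $\lambda$-Fatou property is the same condition restricted to increasing sequences. An SFDR for $T\in B(Z,X)$ is a sequence $Z_1\subset Z_2\subset\cdots$ of finite dimensional subspaces of $Z$ such that $\|T^*x^*\|=\sup_k\sup\{\langle T^*x^*,z\rangle: z\in Z_k,\ \|z\|\le1\}$ for every $x^*\in X^*$. *)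

theory Defs
  imports "HOL-Analysis.Analysis"
begin

section \<open>Operators\<close>

text \<open>The dual space of a Banach space \<open>'a\<close> is the type \<open>'a \<Rightarrow>\<^sub>L real\<close>.\<close>

lift_definition dual_operator ::
    "('z::real_normed_vector \<Rightarrow>\<^sub>L 'x::real_normed_vector) \<Rightarrow> ('x \<Rightarrow>\<^sub>L real) \<Rightarrow>\<^sub>L ('z \<Rightarrow>\<^sub>L real)"
  is "\<lambda>T x'. x' o\<^sub>L T"
  by (rule bounded_bilinear.bounded_linear_left[OF bounded_bilinear_blinfun_compose])

definition compact_operator :: "('z::real_normed_vector \<Rightarrow>\<^sub>L 'x::real_normed_vector) \<Rightarrow> bool" where
  "compact_operator T \<longleftrightarrow> compact (closure (blinfun_apply T ` cball 0 1))"

text \<open>Exponents live in \<open>ennreal\<close>, so that \<open>inverse 0 = \<infinity>\<close> and \<open>inverse \<infinity> = 0\<close>.\<close>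

definition conj_exponent :: "ennreal \<Rightarrow> ennreal" where
  "conj_exponent p = inverse (1 - inverse p)"

lemma inverse_add_inverse_conj_exponent:
  assumes "1 \<le> p"
  shows "inverse p + inverse (conj_exponent p) = 1"
proof -
  have inv_inv: "inverse (inverse x) = x" for x :: ennreal
  proof (cases x)
    case (real r)
    then show ?thesis
      by (cases "r = 0") (auto simp: inverse_ennreal)
  qed simp
  have "inverse p \<le> 1"
  proof (cases p)
    case (real r)
    with assms have "1 \<le> r"
      by (simp flip: ennreal_1)
    with real show ?thesis
      by (simp add: inverse_ennreal inverse_le_1_iff flip: ennreal_1)
  qed simp
  then show ?thesis
    unfolding conj_exponent_def by (simp add: inv_inv)
qed

text \<open>The \<open>\<ell>\<^sub>p\<close> norm of \<open>(a 0, \<dots>, a (n - 1))\<close>; inserting \<open>0\<close> only matters for \<open>n = 0\<close>.\<close>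

definition lp_norm :: "ennreal \<Rightarrow> nat \<Rightarrow> (nat \<Rightarrow> real) \<Rightarrow> real" where
  "lp_norm p n a =
     (if p = \<infinity> then Max (insert 0 ((\<lambda>i. \<bar>a i\<bar>) ` {..<n}))
      else (\<Sum>i<n. \<bar>a i\<bar> powr enn2real p) powr (1 / enn2real p))"

definition weak_norm :: "ennreal \<Rightarrow> nat \<Rightarrow> (nat \<Rightarrow> 'v::real_normed_vector) \<Rightarrow> real" where
  "weak_norm p n z =
     (SUP a \<in> {a. lp_norm (conj_exponent p) n a \<le> 1}. norm (\<Sum>i<n. a i *\<^sub>R z i))"

definition p_summing ::
    "ennreal \<Rightarrow> ('v::real_normed_vector \<Rightarrow>\<^sub>L 'w::real_normed_vector) \<Rightarrow> bool" where
  "p_summing p S \<longleftrightarrow> p = \<infinity> \<or>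
     (\<exists>C\<ge>0. \<forall>n v. lp_norm p n (\<lambda>i. norm (S (v i))) \<le> C * weak_norm p n v)"

definition SFDR ::
    "('z::real_normed_vector \<Rightarrow>\<^sub>L 'x::real_normed_vector) \<Rightarrow> (nat \<Rightarrow> 'z set) \<Rightarrow> bool" where
  "SFDR T Z \<longleftrightarrow>
     (\<forall>k. subspace (Z k) \<and> (\<exists>B. finite B \<and> span B = Z k)) \<and>
     (\<forall>k. Z k \<subseteq> Z (Suc k)) \<and>
     (\<forall>x'. norm (dual_operator T x') =
        (SUP k. SUP z \<in> {z \<in> Z k. norm z \<le> 1}. dual_operator T x' z))"

section \<open>Lattices of positively homogeneous functions on the dual\<close>

text \<open>On \<open>'x \<Rightarrow>\<^sub>L real\<close> the strong operator topology, i.e. the topology of pointwise convergence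
  on \<open>'x\<close>, is the weak-star topology.\<close>

abbreviation weak_star_topology :: "('x::real_normed_vector \<Rightarrow>\<^sub>L real) topology" where
  "weak_star_topology \<equiv> strong_operator_topology"

type_synonym 'x dual_fun = "('x \<Rightarrow>\<^sub>L real) \<Rightarrow> real"

definition Hw :: "'x::banach dual_fun set" where
  "Hw = {f. (\<forall>c\<ge>0. \<forall>x'. f (c *\<^sub>R x') = c * f x') \<and>
            (\<forall>B. bounded B \<longrightarrow>
               continuous_map (subtopology weak_star_topology B) euclideanreal f)}"

text \<open>With \<open>Inf {} = \<infinity>\<close>, the value is \<open>\<infinity>\<close> when no constant works.\<close>

definition hnorm :: "ennreal \<Rightarrow> 'x::banach dual_fun \<Rightarrow> ennreal" where
  "hnorm p f =
     (INF C \<in> {C. C \<ge> 0 \<and> (\<forall>n x'. lp_norm p n (\<lambda>i. f (x' i)) \<le> C * weak_norm p n x')}. ennreal C)"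

definition Hwp :: "ennreal \<Rightarrow> 'x::banach dual_fun set" where
  "Hwp p = {f \<in> Hw. hnorm p f < \<infinity>}"

definition hclosure :: "ennreal \<Rightarrow> 'x::banach dual_fun set \<Rightarrow> 'x dual_fun set" where
  "hclosure p S = {f \<in> Hwp p. \<forall>\<epsilon>>0. \<exists>g\<in>S. hnorm p (\<lambda>x'. f x' - g x') < \<epsilon>}"

definition delta :: "'x::banach \<Rightarrow> 'x dual_fun" where
  "delta x = (\<lambda>x'. blinfun_apply x' x)"

definition linear_subspace :: "('d \<Rightarrow> real) set \<Rightarrow> bool" where
  "linear_subspace V \<longleftrightarrow> (\<lambda>_. 0) \<in> V \<and>
     (\<forall>f\<in>V. \<forall>g\<in>V. (\<lambda>t. f t + g t) \<in> V) \<and> (\<forall>c. \<forall>f\<in>V. (\<lambda>t. c * f t) \<in> V)"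

definition vector_sublattice :: "('d \<Rightarrow> real) set \<Rightarrow> ('d \<Rightarrow> real) set \<Rightarrow> bool" where
  "vector_sublattice H V \<longleftrightarrow> V \<subseteq> H \<and> linear_subspace V \<and>
     (\<forall>f\<in>V. \<forall>g\<in>V. sup f g \<in> V \<and> inf f g \<in> V)"

definition order_ideal :: "('d \<Rightarrow> real) set \<Rightarrow> ('d \<Rightarrow> real) set \<Rightarrow> bool" where
  "order_ideal H V \<longleftrightarrow> V \<subseteq> H \<and> linear_subspace V \<and>
     (\<forall>f\<in>H. \<forall>g\<in>V. (\<forall>t. \<bar>f t\<bar> \<le> \<bar>g t\<bar>) \<longrightarrow> f \<in> V)"

definition FVL :: "'x::banach dual_fun set" where
  "FVL = vector_sublattice Hw hull range delta"

definition FBL :: "ennreal \<Rightarrow> 'x::banach dual_fun set" where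
  "FBL p = hclosure p FVL"

definition Iw :: "'x::banach dual_fun set" where
  "Iw = order_ideal Hw hull range delta"

definition Iwp :: "ennreal \<Rightarrow> 'x::banach dual_fun set" where
  "Iwp p = hclosure p Iw"

section \<open>Fatou properties\<close>

text \<open>A Banach lattice of functions is given by its carrier \<open>L\<close> (with the pointwise order) and its
  norm \<open>N\<close>. The supremum of a subset is taken in \<open>L\<close>, so it need not be the pointwise one.\<close>

definition is_supremum_in :: "('d \<Rightarrow> real) set \<Rightarrow> ('d \<Rightarrow> real) set \<Rightarrow> ('d \<Rightarrow> real) \<Rightarrow> bool" where
  "is_supremum_in L S z0 \<longleftrightarrow> z0 \<in> L \<and> (\<forall>z\<in>S. z \<le> z0) \<and> (\<forall>u\<in>L. (\<forall>z\<in>S. z \<le> u) \<longrightarrow> z0 \<le> u)"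

definition positive_cone :: "('d \<Rightarrow> real) set \<Rightarrow> ('d \<Rightarrow> real) set" where
  "positive_cone L = {z \<in> L. (\<lambda>_. 0) \<le> z}"

definition upward_directed :: "('d \<Rightarrow> real) set \<Rightarrow> bool" where
  "upward_directed S \<longleftrightarrow> S \<noteq> {} \<and> (\<forall>y\<in>S. \<forall>z\<in>S. \<exists>w\<in>S. y \<le> w \<and> z \<le> w)"

definition fatou_property ::
    "real \<Rightarrow> ('d \<Rightarrow> real) set \<Rightarrow> (('d \<Rightarrow> real) \<Rightarrow> ennreal) \<Rightarrow> bool" where
  "fatou_property c L N \<longleftrightarrow>
     (\<forall>S z0. S \<subseteq> positive_cone L \<and> upward_directed S \<and> is_supremum_in L S z0 \<longrightarrow>
        N z0 \<le> ennreal c * (SUP z\<in>S. N z))"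

definition countable_fatou_property ::
    "real \<Rightarrow> ('d \<Rightarrow> real) set \<Rightarrow> (('d \<Rightarrow> real) \<Rightarrow> ennreal) \<Rightarrow> bool" where
  "countable_fatou_property c L N \<longleftrightarrow>
     (\<forall>s z0. range s \<subseteq> positive_cone L \<and> incseq s \<and> is_supremum_in L (range s) z0 \<longrightarrow>
        N z0 \<le> ennreal c * (SUP n::nat. N (s n)))"

end

theory Submission
  imports Defs
begin

text \<open>Fix \<open>z\<close> with \<open>T z \<noteq> 0\<close> and a large \<open>n\<close>, put \<open>f = n |\<delta>\<^bsub>T z\<^esub>|\<close>, and consider the functions
  \<open>0 \<le> h \<le> f\<close> in \<open>FVL\<close> that lie below \<open>g(x') = \<parallel>T\<^sup>* x'\<parallel>\<close>. Their norms are at most the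
  \<open>p\<close>-summing norm of \<open>T\<^sup>*\<close>, and their pointwise supremum is \<open>min f g\<close>. Because \<open>T\<close> is not
  compact, \<open>g\<close> stays bounded away from \<open>0\<close> along a bounded net \<open>y\<close> that is weak-star null; at
  \<open>x' + t y\<close> with \<open>t\<close> large, \<open>g\<close> exceeds \<open>f\<close> while \<open>f\<close> tends to \<open>f x'\<close>. By weak-star continuity
  every upper bound in the lattice therefore dominates \<open>f\<close>, so \<open>f\<close> is the supremum in the
  lattice, and its norm grows with \<open>n\<close>. An SFDR provides a countable norming set for all
  \<open>T\<^sup>* x'\<close>, which turns the family into a sequence.\<close>

section \<open>The Hahn--Banach theorem for sublinear functionals\<close>

definition sublinear :: "('a::real_vector \<Rightarrow> real) \<Rightarrow> bool" where
  "sublinear q \<longleftrightarrow> (\<forall>x y. q (x + y) \<le> q x + q y) \<and> (\<forall>c>0. \<forall>x. q (c *\<^sub>R x) = c * q x)"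

lemma sublinear_add: "sublinear q \<Longrightarrow> q (x + y) \<le> q x + q y"
  and sublinear_scale_pos: "sublinear q \<Longrightarrow> c > 0 \<Longrightarrow> q (c *\<^sub>R x) = c * q x"
  unfolding sublinear_def by blast+

lemma sublinear_zero: "sublinear q \<Longrightarrow> q 0 = 0"
  using sublinear_scale_pos[of q 2 0] by simp

lemma sublinear_scale: "sublinear q \<Longrightarrow> c \<ge> 0 \<Longrightarrow> q (c *\<^sub>R x) = c * q x"
  by (cases "c = 0") (simp_all add: sublinear_zero sublinear_scale_pos)

lemma sublinear_minus_ge: "sublinear q \<Longrightarrow> - q (- x) \<le> q x"
  using sublinear_add[of q x "- x"] by (simp add: sublinear_zero)

text \<open>Indices may be chosen separately at \<open>x\<close> and at \<open>y\<close>, so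
  \<open>add\<close> asks for one index serving the sum; the bound \<open>b x\<close> keeps each
  real infimum meaningful. In \<open>scale\<close> an inequality is enough: used with the factor
  \<open>inverse c\<close> at the point \<open>c *\<^sub>R x\<close>, it gives the reverse
  one.\<close>

lemma sublinear_INF:
  fixes \<phi> :: "'i \<Rightarrow> 'a::real_vector \<Rightarrow> real"
  assumes ne: "I \<noteq> {}"
    and bdd: "\<And>i x. i \<in> I \<Longrightarrow> b x \<le> \<phi> i x"
    and add: "\<And>i j x y. i \<in> I \<Longrightarrow> j \<in> I \<Longrightarrow> \<exists>k\<in>I. \<phi> k (x + y) \<le> \<phi> i x + \<phi> j y"
    and scale: "\<And>i c x. i \<in> I \<Longrightarrow> c > 0 \<Longrightarrow> \<exists>k\<in>I. \<phi> k (c *\<^sub>R x) \<le> c * \<phi> i x"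
  shows "sublinear (\<lambda>x. INF i\<in>I. \<phi> i x)"
proof -
  define q where "q = (\<lambda>x. INF i\<in>I. \<phi> i x)"
  have bdd': "bdd_below ((\<lambda>i. \<phi> i x) ` I)" for x
    using bdd by (intro bdd_belowI2)
  have lower: "q x \<le> \<phi> i x" if "i \<in> I" for i x
    unfolding q_def using bdd' that by (rule cINF_lower)
  have greatest: "r \<le> q x" if "\<And>i. i \<in> I \<Longrightarrow> r \<le> \<phi> i x" for r x
    unfolding q_def using ne that by (rule cINF_greatest)
  have sub: "q (x + y) \<le> q x + q y" for x y
  proof -
    have "q (x + y) - \<phi> i x \<le> \<phi> j y" if ij: "i \<in> I" "j \<in> I" for i j
    proof -
      obtain k where "k \<in> I" "\<phi> k (x + y) \<le> \<phi> i x + \<phi> j y"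
        using add[OF ij] by blast
      then show ?thesis
        using lower[of k "x + y"] by simp
    qed
    then have "q (x + y) - \<phi> i x \<le> q y" if "i \<in> I" for i
      using greatest that by blast
    then have "q (x + y) - q y \<le> \<phi> i x" if "i \<in> I" for i
      using that by (simp add: algebra_simps)
    then show ?thesis
      using greatest[of "q (x + y) - q y" x] by simp
  qed
  have half: "q (c *\<^sub>R x) \<le> c * q x" if "c > 0" for c x
  proof -
    have "q (c *\<^sub>R x) / c \<le> \<phi> i x" if i: "i \<in> I" for i
    proof -
      obtain k where "k \<in> I" "\<phi> k (c *\<^sub>R x) \<le> c * \<phi> i x"
        using scale[OF i \<open>c > 0\<close>] by blast
      then have "q (c *\<^sub>R x) \<le> c * \<phi> i x"
        using lower[of k "c *\<^sub>R x"] by simp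
      then show ?thesis
        using \<open>c > 0\<close> by (simp add: field_simps)
    qed
    then show ?thesis
      using greatest[of "q (c *\<^sub>R x) / c" x] \<open>c > 0\<close> by (simp add: field_simps)
  qed
  have "q (c *\<^sub>R x) = c * q x" if c: "c > 0" for c x
  proof (rule antisym)
    have "q (inverse c *\<^sub>R (c *\<^sub>R x)) \<le> inverse c * q (c *\<^sub>R x)"
      using c by (intro half) simp
    then show "c * q x \<le> q (c *\<^sub>R x)"
      using c by (simp add: field_simps)
  qed (use c half in simp)
  with sub show ?thesis
    unfolding sublinear_def q_def[symmetric] by blast
qed

text \<open>For sublinear \<open>q\<close> this is the greatest sublinear functional below
  \<open>q\<close> whose value at \<open>- v\<close> is at most \<open>- q v\<close>; the parameter
  \<open>t\<close> comes from splitting \<open>x\<close> into \<open>x + t *\<^sub>R v\<close> and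
  \<open>- t *\<^sub>R v\<close>.\<close>

definition tilt :: "('a::real_vector \<Rightarrow> real) \<Rightarrow> 'a \<Rightarrow> 'a \<Rightarrow> real" where
  "tilt q v = (\<lambda>x. INF t\<in>{0..}. q (x + t *\<^sub>R v) - t * q v)"

lemma
  assumes q: "sublinear q"
  shows sublinear_tilt: "sublinear (tilt q v)"
    and tilt_le: "tilt q v x \<le> q x"
    and tilt_minus: "tilt q v (- v) \<le> - q v"
proof -
  \<comment> \<open>A lower bound independent of \<open>t\<close>: here
    \<open>t * q v = q (t *\<^sub>R v)\<close>, and \<open>t *\<^sub>R v\<close> is the sum of
    \<open>x + t *\<^sub>R v\<close> and \<open>- x\<close>.\<close>
  have bdd: "- q (- x) \<le> q (x + t *\<^sub>R v) - t * q v" if "t \<in> {0..}" for t x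
    using sublinear_add[OF q, of "x + t *\<^sub>R v" "- x"] sublinear_scale[OF q, of t v] that by simp
  have lower: "tilt q v x \<le> q (x + t *\<^sub>R v) - t * q v" if "t \<ge> 0" for t x
    unfolding tilt_def by (rule cINF_lower[OF bdd_belowI2[OF bdd]]) (use that in auto)
  show "sublinear (tilt q v)"
    unfolding tilt_def
  proof (rule sublinear_INF)
    show "\<exists>k\<in>{0..}. q (x + y + k *\<^sub>R v) - k * q v
            \<le> q (x + i *\<^sub>R v) - i * q v + (q (y + j *\<^sub>R v) - j * q v)"
      if "i \<in> {0..}" "j \<in> {0..}" for i j :: real and x y
      using that sublinear_add[OF q, of "x + i *\<^sub>R v" "y + j *\<^sub>R v"]
      by (intro bexI[of _ "i + j"]) (auto simp: algebra_simps)
    show "\<exists>k\<in>{0..}. q (c *\<^sub>R x + k *\<^sub>R v) - k * q v \<le> c * (q (x + i *\<^sub>R v) - i * q v)"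
      if "i \<in> {0..}" "c > 0" for i c :: real and x
      using that sublinear_scale[OF q, of c "x + i *\<^sub>R v"]
      by (intro bexI[of _ "c * i"]) (auto simp: algebra_simps)
  qed (use bdd in auto)
  show "tilt q v x \<le> q x"
    using lower[of 0 x] by simp
  show "tilt q v (- v) \<le> - q v"
    using lower[of 1 "- v"] sublinear_zero[OF q] by simp
qed

text \<open>A pointwise minimal sublinear functional \<open>m\<close> is linear: minimality forces
  \<open>tilt m w = m\<close>, so \<open>m (- w) \<le> - m w\<close> for every \<open>w\<close>. Minimising below \<open>tilt q v\<close> rather
  than below \<open>q\<close> keeps the value at \<open>v\<close>.\<close>

theorem Hahn_Banach_sublinear:
  fixes q :: "'a::real_vector \<Rightarrow> real"
  assumes q: "sublinear q"
  obtains f where "linear f" "\<And>x. f x \<le> q x" "f v = q v"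
proof -
  define A where "A = {r. sublinear r \<and> r \<le> tilt q v}"
  have "\<exists>m\<in>A. \<forall>r\<in>A. m \<ge> r \<longrightarrow> r = m"
  proof (rule predicate_Zorn)
    show "partial_order_on A (relation_of (\<ge>) A)"
      by (rule partial_order_on_relation_ofI) auto
    show "\<exists>u\<in>A. \<forall>r\<in>C. u \<le> r" if C: "C \<in> Chains (relation_of (\<ge>) A)" for C
    proof (cases "C = {}")
      case True
      then show ?thesis
        using sublinear_tilt[OF q] by (auto simp: A_def)
    next
      case False
      have tot: "r \<le> s \<or> s \<le> r" if "r \<in> C" "s \<in> C" for r s
        using C that by (auto simp: Chains_def relation_of_def)
      have CA: "r \<in> A" if "r \<in> C" for r
        using C that by (auto simp: Chains_def relation_of_def)
      \<comment> \<open>Members of the chain satisfy \<open>- r (- x) \<le> r x\<close> and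
        \<open>r (- x) \<le> tilt q v (- x)\<close>, which bounds them from below uniformly in
        \<open>r\<close>.\<close>
      have bdd: "- tilt q v (- x) \<le> r x" if "r \<in> C" for r x
        using CA[OF that] sublinear_minus_ge[of r x] unfolding A_def le_fun_def
        by (smt (verit) mem_Collect_eq)
      define u where "u = (\<lambda>x. INF r\<in>C. r x)"
      have lower: "u \<le> r" if "r \<in> C" for r
        unfolding u_def le_fun_def
        by (intro allI cINF_lower[OF bdd_belowI2[OF bdd]] that)
      have "sublinear u"
        unfolding u_def
      proof (rule sublinear_INF[OF False])
        show "\<exists>k\<in>C. k (x + y) \<le> i x + j y" if "i \<in> C" "j \<in> C" for i j x y
        proof -
          have "\<exists>k\<in>C. k \<le> i \<and> k \<le> j"
            using tot[OF that] that by blast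
          then obtain k where k: "k \<in> C" "k \<le> i" "k \<le> j"
            by blast
          have "k (x + y) \<le> k x + k y"
            using CA[OF k(1)] by (simp add: A_def sublinear_add)
          also have "\<dots> \<le> i x + j y"
            using k by (intro add_mono) (simp_all add: le_fun_def)
          finally show ?thesis
            using k(1) by blast
        qed
        show "\<exists>k\<in>C. k (c *\<^sub>R x) \<le> c * i x" if "i \<in> C" "c > 0" for i c x
          using CA[OF that(1)] that sublinear_scale_pos[of i c x]
          by (intro bexI[of _ i]) (auto simp: A_def)
      qed (rule bdd)
      moreover have "u \<le> tilt q v"
        using False lower CA unfolding A_def
        by (metis (no_types, lifting) all_not_in_conv mem_Collect_eq order_trans)
      ultimately show ?thesis
        using lower by (auto simp: A_def)
    qed
  qed
  then obtain m where m: "sublinear m" "m \<le> tilt q v"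
    and min: "\<And>r. sublinear r \<Longrightarrow> r \<le> m \<Longrightarrow> r = m"
    unfolding A_def by (metis (mono_tags, lifting) mem_Collect_eq order_trans)
  have "tilt m w = m" for w
    using m(1) by (intro min) (simp_all add: sublinear_tilt tilt_le le_fun_def)
  then have minus: "m (- w) = - m w" for w
    using tilt_minus[OF m(1), of w] sublinear_minus_ge[OF m(1), of "- w"] by simp
  have "m (x + y) = m x + m y" for x y
    using sublinear_add[OF m(1), of x y] sublinear_add[OF m(1), of "- x" "- y"]
      minus[of x] minus[of y] minus[of "x + y"] by simp
  moreover have "m (c *\<^sub>R x) = c * m x" for c x
    using sublinear_scale[OF m(1), of c x] sublinear_scale[OF m(1), of "- c" x]
      minus[of "c *\<^sub>R x"] by (cases "c \<ge> 0") simp_all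
  ultimately have "linear m"
    by (intro linearI) simp_all
  moreover have le: "m x \<le> q x" for x
    using m(2) tilt_le[OF q, of v x] by (auto simp: le_fun_def intro: order_trans)
  \<comment> \<open>The tilt gives \<open>m (- v) \<le> - q v\<close>, and oddness of
    \<open>m\<close> turns this into the missing bound \<open>q v \<le> m v\<close>.\<close>
  moreover have "m v = q v"
    using le[of v] le_funD[OF m(2), of "- v"] tilt_minus[OF q, of v] minus[of v] by simp
  ultimately show ?thesis
    using that by blast
qed

section \<open>Non-compact operators and their adjoints\<close>

text \<open>Bounding the coefficients instead of the vectors gives compactness even when
  \<open>F\<close> is linearly dependent: each new generator contributes an interval, and addition
  maps the product continuously onto the larger set.\<close>

lemma compact_box_combinations:
  fixes F :: "'a::real_normed_vector set"
  assumes "finite F"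
  shows "compact {\<Sum>y\<in>F. a y *\<^sub>R y | a. \<forall>y\<in>F. \<bar>a y\<bar> \<le> r}"
  using assms
proof (induction F rule: finite_induct)
  case empty
  then show ?case by simp
next
  case (insert z F)
  let ?K = "{\<Sum>y\<in>F. a y *\<^sub>R y | a. \<forall>y\<in>F. \<bar>a y\<bar> \<le> r}"
  have "{\<Sum>y\<in>insert z F. a y *\<^sub>R y | a. \<forall>y\<in>insert z F. \<bar>a y\<bar> \<le> r}
      = (\<lambda>(t, k). t *\<^sub>R z + k) ` ({- r..r} \<times> ?K)" (is "?L = ?R")
  proof (intro equalityI subsetI)
    fix x assume "x \<in> ?L"
    then obtain a where "x = (\<Sum>y\<in>insert z F. a y *\<^sub>R y)" "\<forall>y\<in>insert z F. \<bar>a y\<bar> \<le> r"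
      by blast
    with insert.hyps show "x \<in> ?R"
      by (intro image_eqI[of _ _ "(a z, \<Sum>y\<in>F. a y *\<^sub>R y)"]) (auto simp: abs_le_iff)
  next
    fix x assume "x \<in> ?R"
    then obtain t a where x: "x = t *\<^sub>R z + (\<Sum>y\<in>F. a y *\<^sub>R y)"
      and "\<bar>t\<bar> \<le> r" "\<forall>y\<in>F. \<bar>a y\<bar> \<le> r"
      by (auto simp: abs_le_iff)
    moreover have "(\<Sum>y\<in>F. (a(z := t)) y *\<^sub>R y) = (\<Sum>y\<in>F. a y *\<^sub>R y)"
      using insert.hyps by (intro sum.cong) auto
    ultimately show "x \<in> ?L"
      using insert.hyps by (intro CollectI exI[of _ "a(z := t)"]) auto
  qed
  moreover have "compact ?R"
    unfolding case_prod_beta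
    by (intro compact_continuous_image compact_Times insert.IH continuous_intros) simp
  ultimately show ?case
    by simp
qed

text \<open>Compactness of \<open>T\<close> is read off from its adjoint near \<open>0\<close>: otherwise the functional that
  measures the distance to the bounded part of \<open>span F\<close> would be small on the image of the ball.\<close>

lemma noncompact_operator_adjoint_not_weak_star_null:
  fixes T :: "'z::real_normed_vector \<Rightarrow>\<^sub>L 'x::banach"
  assumes "\<not> compact_operator T"
  obtains \<delta> where "\<delta> > 0"
    "\<And>F \<epsilon>. finite F \<Longrightarrow> \<epsilon> > 0 \<Longrightarrow>
      \<exists>x'. norm x' \<le> 1 \<and> (\<forall>y\<in>F. \<bar>blinfun_apply x' y\<bar> \<le> \<epsilon>) \<and> \<delta> \<le> norm (dual_operator T x')"
proof (rule ccontr)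
  assume "\<not> thesis"
  with that have small: "\<exists>F \<epsilon>. finite F \<and> \<epsilon> > 0 \<and>
      (\<forall>x'. norm x' \<le> 1 \<longrightarrow> (\<forall>y\<in>F. \<bar>blinfun_apply x' y\<bar> \<le> \<epsilon>) \<longrightarrow> norm (dual_operator T x') < \<delta>)"
    if "\<delta> > 0" for \<delta>
    using \<open>\<delta> > 0\<close> by (metis not_le)
  have "\<exists>k. finite k \<and> closure (T ` cball 0 1) \<subseteq> (\<Union>x\<in>k. ball x e)" if "e > 0" for e
  proof -
    \<comment> \<open>The error budget: \<open>e / 4\<close> for the distance of \<open>T z\<close>
      to a compact set \<open>K\<close> and \<open>e / 4\<close> for a finite net of
      \<open>K\<close>. The slack between \<open>e / 2\<close> and \<open>e\<close> allows closed
      balls, whose finite union also covers the closure.\<close>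
    obtain F \<epsilon> where F: "finite F" "\<epsilon> > 0"
      and sm: "\<And>x'. norm x' \<le> 1 \<Longrightarrow> \<forall>y\<in>F. \<bar>blinfun_apply x' y\<bar> \<le> \<epsilon> \<Longrightarrow>
        norm (dual_operator T x') < e / 4"
      using small[of "e / 4"] \<open>e > 0\<close> by auto
    \<comment> \<open>\<open>q\<close> is the infimal convolution of the norm with a weighted
      coefficient sum on the span of \<open>F\<close>. The linear functionals below \<open>q\<close>
      are exactly those of norm at most 1 that are bounded by \<open>\<epsilon>\<close> on
      \<open>F\<close>.\<close>
    define \<phi> where "\<phi> a x = norm (x - (\<Sum>y\<in>F. a y *\<^sub>R y)) + \<epsilon> * (\<Sum>y\<in>F. \<bar>a y\<bar>)" for a x
    define q where "q x = (INF a. \<phi> a x)" for x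
    have \<phi>_nonneg: "0 \<le> \<phi> a x" for a x
      using F by (auto simp: \<phi>_def intro!: add_nonneg_nonneg mult_nonneg_nonneg sum_nonneg)
    have q_le: "q x \<le> \<phi> a x" for a x
      unfolding q_def by (rule cINF_lower[OF bdd_belowI2[OF \<phi>_nonneg]]) simp
    have q: "sublinear q"
      unfolding q_def
    proof (rule sublinear_INF)
      show "\<exists>k\<in>UNIV. \<phi> k (x + y) \<le> \<phi> a x + \<phi> b y" for a b x y
      proof (rule bexI)
        have "(\<Sum>y\<in>F. \<bar>a y + b y\<bar>) \<le> (\<Sum>y\<in>F. \<bar>a y\<bar>) + (\<Sum>y\<in>F. \<bar>b y\<bar>)"
          unfolding sum.distrib[symmetric] by (intro sum_mono) simp
        then have "\<epsilon> * (\<Sum>y\<in>F. \<bar>a y + b y\<bar>) \<le> \<epsilon> * (\<Sum>y\<in>F. \<bar>a y\<bar>) + \<epsilon> * (\<Sum>y\<in>F. \<bar>b y\<bar>)"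
          using F by (simp flip: distrib_left)
        moreover have "norm (x + y - (\<Sum>y\<in>F. (a y + b y) *\<^sub>R y))
            \<le> norm (x - (\<Sum>y\<in>F. a y *\<^sub>R y)) + norm (y - (\<Sum>y\<in>F. b y *\<^sub>R y))"
          by (intro order_trans[OF eq_refl norm_triangle_ineq] arg_cong[where f = norm])
            (simp add: scaleR_left_distrib sum.distrib)
        ultimately show "\<phi> (\<lambda>y. a y + b y) (x + y) \<le> \<phi> a x + \<phi> b y"
          unfolding \<phi>_def by simp
      qed simp
      show "\<exists>k\<in>UNIV. \<phi> k (c *\<^sub>R x) \<le> c * \<phi> a x" if c: "c > 0" for a c x
      proof (rule bexI)
        have "c *\<^sub>R x - (\<Sum>y\<in>F. (c * a y) *\<^sub>R y) = c *\<^sub>R (x - (\<Sum>y\<in>F. a y *\<^sub>R y))"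
          by (simp add: scaleR_right_diff_distrib scaleR_sum_right)
        then have "norm (c *\<^sub>R x - (\<Sum>y\<in>F. (c * a y) *\<^sub>R y))
            = c * norm (x - (\<Sum>y\<in>F. a y *\<^sub>R y))"
          using c by (simp only: norm_scaleR)
        then show "\<phi> (\<lambda>y. c * a y) (c *\<^sub>R x) \<le> c * \<phi> a x"
          using c unfolding \<phi>_def
          by (simp add: abs_mult distrib_left sum_distrib_left mult.left_commute)
      qed simp
    qed (use \<phi>_nonneg in auto)
    have q_norm: "q x \<le> norm x" for x
      using q_le[of x "\<lambda>_. 0"] by (simp add: \<phi>_def)
    have q_F: "q (s *\<^sub>R y) \<le> \<epsilon>" if y: "y \<in> F" and s: "\<bar>s\<bar> = 1" for s y
    proof -
      have "(\<Sum>w\<in>F. (if w = y then s else 0) *\<^sub>R w) = s *\<^sub>R y"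
        using F y by (simp add: if_distrib[of "\<lambda>t. t *\<^sub>R _"] cong: if_cong)
      moreover have "(\<Sum>w\<in>F. \<bar>if w = y then s else 0\<bar>) = 1"
        using F y s by (simp add: if_distrib[of abs] cong: if_cong)
      ultimately show ?thesis
        using q_le[of "s *\<^sub>R y" "\<lambda>w. if w = y then s else 0"] by (simp add: \<phi>_def)
    qed
    \<comment> \<open>A functional below \<open>q\<close> that touches \<open>q\<close> at
      \<open>T z\<close> is admissible in \<open>sm\<close>; hence \<open>q (T z)\<close>, which is
      the value of \<open>dual_operator T x'\<close> at \<open>z\<close>, is small.\<close>
    have q_T: "q (T z) < e / 4" if z: "norm z \<le> 1" for z
    proof -
      obtain f where f: "linear f" "\<And>x. f x \<le> q x" "f (T z) = q (T z)"
        using Hahn_Banach_sublinear[OF q] by blast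
      have abs_f: "\<bar>f x\<bar> \<le> norm x" for x
        using f(2)[of x] f(2)[of "- x"] q_norm[of x] q_norm[of "- x"] linear_neg[OF f(1), of x]
        by simp
      then have bl: "bounded_linear f"
        using f(1) by (auto simp: linear_linear intro!: bounded_linear_intro[of f 1]
            linear_add linear_scale[of f, simplified])
      define x' where "x' = Blinfun f"
      have x': "blinfun_apply x' = f"
        unfolding x'_def using bl by (rule bounded_linear_Blinfun_apply)
      have "norm x' \<le> 1"
        using abs_f by (intro norm_blinfun_bound) (simp_all add: x')
      moreover have "\<forall>y\<in>F. \<bar>blinfun_apply x' y\<bar> \<le> \<epsilon>"
      proof
        fix y assume "y \<in> F"
        then show "\<bar>blinfun_apply x' y\<bar> \<le> \<epsilon>"
          using q_F[of y 1] q_F[of y "- 1"] f(2)[of y] f(2)[of "- y"] linear_neg[OF f(1), of y]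
          by (simp add: x')
      qed
      ultimately have "norm (dual_operator T x') < e / 4"
        by (rule sm)
      moreover have "q (T z) \<le> norm (dual_operator T x') * norm z"
        using norm_blinfun[of "dual_operator T x'" z] f(3)
        by (simp add: x' dual_operator.rep_eq)
      moreover have "norm (dual_operator T x') * norm z \<le> norm (dual_operator T x')"
        using z by (simp add: mult_left_le)
      ultimately show ?thesis
        by simp
    qed
    \<comment> \<open>The radius is forced by the penalty: \<open>\<phi> a (T z) < e / 4\<close>
      implies \<open>\<epsilon> * \<bar>a y\<bar> \<le> e / 4\<close> for each \<open>y\<close> in
      \<open>F\<close>.\<close>
    define K where "K = {\<Sum>y\<in>F. a y *\<^sub>R y | a. \<forall>y\<in>F. \<bar>a y\<bar> \<le> e / 4 / \<epsilon>}"
    have "compact K"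
      unfolding K_def using F(1) by (rule compact_box_combinations)
    then obtain k where k: "finite k" "K \<subseteq> (\<Union>x\<in>k. ball x (e / 4))"
      using \<open>e > 0\<close> unfolding compact_eq_totally_bounded
      by (metis divide_pos_pos zero_less_numeral)
    have "T z \<in> (\<Union>x\<in>k. cball x (e / 2))" if "norm z \<le> 1" for z
    proof -
      have "\<exists>a. \<phi> a (T z) < e / 4"
        using q_T[OF that] cINF_greatest[of UNIV "e / 4" "\<lambda>a. \<phi> a (T z)"]
        unfolding q_def by (metis UNIV_not_empty not_le)
      then obtain a where a: "\<phi> a (T z) < e / 4" ..
      have "\<epsilon> * \<bar>a y\<bar> \<le> e / 4" if "y \<in> F" for y
      proof -
        have "\<bar>a y\<bar> \<le> (\<Sum>y\<in>F. \<bar>a y\<bar>)"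
          using F(1) that by (intro member_le_sum) auto
        then have "\<epsilon> * \<bar>a y\<bar> \<le> \<epsilon> * (\<Sum>y\<in>F. \<bar>a y\<bar>)"
          using F(2) by simp
        then show ?thesis
          using a norm_ge_zero[of "T z - (\<Sum>y\<in>F. a y *\<^sub>R y)"] unfolding \<phi>_def by linarith
      qed
      then have "(\<Sum>y\<in>F. a y *\<^sub>R y) \<in> K"
        unfolding K_def using F(2) by (intro CollectI exI[of _ a]) (auto simp: field_simps)
      then obtain x where x: "x \<in> k" "dist x (\<Sum>y\<in>F. a y *\<^sub>R y) < e / 4"
        using k(2) by auto
      have "0 \<le> \<epsilon> * (\<Sum>y\<in>F. \<bar>a y\<bar>)"
        using F(2) by (simp add: sum_nonneg)
      then have "dist (\<Sum>y\<in>F. a y *\<^sub>R y) (T z) < e / 4"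
        using a unfolding \<phi>_def by (simp add: dist_norm norm_minus_commute)
      then have "dist x (T z) \<le> e / 2"
        using x(2) dist_triangle[of x "T z" "\<Sum>y\<in>F. a y *\<^sub>R y"] by linarith
      then show ?thesis
        using x(1) by auto
    qed
    then have "T ` cball 0 1 \<subseteq> (\<Union>x\<in>k. cball x (e / 2))"
      by auto
    then have "closure (T ` cball 0 1) \<subseteq> (\<Union>x\<in>k. cball x (e / 2))"
      using k(1) by (intro closure_minimal closed_UN) auto
    also have "\<dots> \<subseteq> (\<Union>x\<in>k. ball x e)"
      using \<open>e > 0\<close> by force
    finally show ?thesis
      using k(1) by blast
  qed
  then have "compact (closure (T ` cball 0 1))"
    by (auto simp: compact_eq_totally_bounded complete_eq_closed)
  with assms show False
    by (simp add: compact_operator_def)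
qed

section \<open>Norms\<close>

lemma lp_norm_mono:
  assumes "\<And>i. i < n \<Longrightarrow> \<bar>a i\<bar> \<le> \<bar>b i\<bar>"
  shows "lp_norm p n a \<le> lp_norm p n b"
proof (cases "p = \<infinity>")
  case True
  have "Max (insert 0 ((\<lambda>i. \<bar>a i\<bar>) ` {..<n})) \<le> Max (insert 0 ((\<lambda>i. \<bar>b i\<bar>) ` {..<n}))"
    using assms by (subst Max_le_iff) (auto simp: Max_ge_iff)
  with True show ?thesis
    by (simp add: lp_norm_def)
next
  case False
  have "(\<Sum>i<n. \<bar>a i\<bar> powr enn2real p) \<le> (\<Sum>i<n. \<bar>b i\<bar> powr enn2real p)"
    using assms by (intro sum_mono powr_mono2) auto
  with False show ?thesis
    by (auto simp: lp_norm_def intro!: powr_mono2 sum_nonneg)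
qed

lemma one_le_enn2real:
  assumes "1 \<le> p" "p \<noteq> \<infinity>"
  shows "1 \<le> enn2real p"
  using assms by (cases p) (auto simp flip: ennreal_1)

lemma lp_norm_scale:
  assumes "1 \<le> p" "c \<ge> 0"
  shows "lp_norm p n (\<lambda>i. c * a i) = c * lp_norm p n a"
proof (cases "p = \<infinity>")
  case True
  have "mono (\<lambda>t::real. c * t)"
    using assms by (auto intro: monoI mult_left_mono)
  then have "c * Max (insert 0 ((\<lambda>i. \<bar>a i\<bar>) ` {..<n})) = Max ((\<lambda>t. c * t) ` insert 0 ((\<lambda>i. \<bar>a i\<bar>) ` {..<n}))"
    by (intro mono_Max_commute) auto
  with True assms show ?thesis
    by (simp add: lp_norm_def image_image abs_mult)
next
  case False
  have "(c powr enn2real p * s) powr (1 / enn2real p) = c * s powr (1 / enn2real p)" if "s \<ge> 0" for s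
    using one_le_enn2real[OF assms(1) False] assms(2) that by (simp add: powr_mult powr_powr)
  from this[of "\<Sum>i<n. \<bar>a i\<bar> powr enn2real p"] False assms(2) show ?thesis
    by (simp add: lp_norm_def abs_mult powr_mult sum_distrib_left sum_nonneg)
qed

lemma lp_norm_singleton:
  assumes "1 \<le> p"
  shows "lp_norm p 1 a = \<bar>a 0\<bar>"
proof (cases "p = \<infinity>")
  case False
  then show ?thesis
    using one_le_enn2real[OF assms False] by (simp add: lp_norm_def powr_powr)
qed (simp add: lp_norm_def lessThan_Suc)

text \<open>The conjugate exponent of \<infinity> is 1, so the coefficient vector with value 1 at
  \<open>i\<close> and 0 elsewhere competes in the supremum. As this is a supremum of reals, the
  competing values must first be bounded above.\<close>

lemma norm_le_weak_norm_infinity: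
  assumes "i < n"
  shows "norm (v i) \<le> weak_norm \<infinity> n v"
proof -
  have "conj_exponent \<infinity> = 1"
    by (simp add: conj_exponent_def inverse_ennreal flip: ennreal_1)
  then have wn: "weak_norm \<infinity> n v = (SUP a \<in> {a. (\<Sum>i<n. \<bar>a i\<bar>) \<le> 1}. norm (\<Sum>i<n. a i *\<^sub>R v i))"
    by (simp add: weak_norm_def lp_norm_def sum_nonneg)
  have "norm (\<Sum>i<n. a i *\<^sub>R v i) \<le> (\<Sum>i<n. norm (v i))" if a: "(\<Sum>i<n. \<bar>a i\<bar>) \<le> 1" for a
  proof -
    have "\<bar>a i\<bar> \<le> 1" if "i < n" for i
      using a that member_le_sum[of i "{..<n}" "\<lambda>i. \<bar>a i\<bar>"] by simp
    then show ?thesis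
      by (intro order_trans[OF norm_sum] sum_mono) (simp add: mult_left_le_one_le)
  qed
  then have bdd: "bdd_above ((\<lambda>a. norm (\<Sum>i<n. a i *\<^sub>R v i)) ` {a. (\<Sum>i<n. \<bar>a i\<bar>) \<le> 1})"
    by (intro bdd_aboveI2) auto
  define a where "a = (\<lambda>j. if j = i then 1 else 0 :: real)"
  have "(\<Sum>i<n. \<bar>a i\<bar>) = 1" and av: "(\<Sum>i<n. a i *\<^sub>R v i) = v i"
    using assms by (simp_all add: a_def if_distrib[of abs] if_distrib[of "\<lambda>t. t *\<^sub>R _"] cong: if_cong)
  then have "a \<in> {a. (\<Sum>i<n. \<bar>a i\<bar>) \<le> 1}"
    by simp
  from cSUP_upper[OF this bdd] show ?thesis
    unfolding wn av .
qed

lemma weak_norm_infinity_nonneg: "0 \<le> weak_norm \<infinity> n v"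
proof (cases n)
  case 0
  have "lp_norm (conj_exponent \<infinity>) 0 a \<le> 1" for a
    by (simp add: lp_norm_def)
  with 0 show ?thesis
    by (simp add: weak_norm_def)
next
  case (Suc m)
  then show ?thesis
    using norm_le_weak_norm_infinity[of 0 n v] norm_ge_zero[of "v 0"] by linarith
qed

text \<open>For \<open>p = \<infinity>\<close> the definition of \<open>p_summing\<close> contains
  no inequality; there the operator norm serves as the constant, so that all exponents can be
  treated alike.\<close>

lemma p_summingE:
  assumes "p_summing p S"
  obtains C where "C \<ge> 0"
    "\<And>n v. lp_norm p n (\<lambda>i. norm (blinfun_apply S (v i))) \<le> C * weak_norm p n v"
proof (cases "p = \<infinity>")
  case True
  have "lp_norm \<infinity> n (\<lambda>i. norm (blinfun_apply S (v i))) \<le> norm S * weak_norm \<infinity> n v" for n v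
  proof -
    have "norm (S (v i)) \<le> norm S * weak_norm \<infinity> n v" if "i < n" for i
      using norm_blinfun[of S "v i"] norm_le_weak_norm_infinity[OF that, of v]
      by (meson mult_left_mono norm_ge_zero order_trans)
    then show ?thesis
      using weak_norm_infinity_nonneg[of n v] by (auto simp: lp_norm_def)
  qed
  then show ?thesis
    using that[of "norm S"] True by simp
next
  case False
  then show ?thesis
    using assms that unfolding p_summing_def by blast
qed

lemma hnorm_le:
  assumes "C \<ge> 0" "\<And>n x'. lp_norm p n (\<lambda>i. f (x' i)) \<le> C * weak_norm p n x'"
  shows "hnorm p f \<le> ennreal C"
  unfolding hnorm_def using assms by (intro INF_lower) simp

text \<open>Testing with the single functional \<open>x'\<close> bounds every admissible constant
  from below. The absolute value and the added 1 make the denominator positive whatever the weak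
  norm is; any fixed positive factor will do, since the bound is applied to large multiples of a
  function.\<close>

lemma hnorm_ge:
  assumes "1 \<le> p"
  shows "ennreal (\<bar>f x'\<bar> / (\<bar>weak_norm p 1 (\<lambda>_. x')\<bar> + 1)) \<le> hnorm p f"
  unfolding hnorm_def
proof (rule INF_greatest, clarify, rule ennreal_leI)
  let ?W = "weak_norm p 1 (\<lambda>_. x')"
  fix C :: real
  assume C: "0 \<le> C" "\<forall>n x'. lp_norm p n (\<lambda>i. f (x' i)) \<le> C * weak_norm p n x'"
  have "\<bar>f x'\<bar> \<le> C * ?W"
    using C(2)[rule_format, of 1 "\<lambda>_. x'"] by (simp only: lp_norm_singleton[OF assms])
  also have "\<dots> \<le> C * (\<bar>?W\<bar> + 1)"
    using C(1) by (intro mult_left_mono) auto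
  finally show "\<bar>f x'\<bar> / (\<bar>?W\<bar> + 1) \<le> C"
    by (simp add: pos_divide_le_eq)
qed

lemma hnorm_zero: "1 \<le> p \<Longrightarrow> hnorm p (\<lambda>_. 0) = 0"
  using hnorm_le[of 0 p "\<lambda>_. 0"] lp_norm_scale[of p 0 _ "\<lambda>_. 0"] by simp

lemma mem_hclosure:
  assumes "1 \<le> p" "f \<in> S" "f \<in> Hwp p"
  shows "f \<in> hclosure p S"
  unfolding hclosure_def using assms by (auto intro!: bexI[of _ f] simp: hnorm_zero)

section \<open>Function lattices on the dual\<close>

lemma HwI:
  assumes "\<And>c x'. c \<ge> 0 \<Longrightarrow> f (c *\<^sub>R x') = c * f x'"
    and "continuous_map weak_star_topology euclideanreal f"
  shows "f \<in> Hw"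
  using assms by (auto simp: Hw_def continuous_map_from_subtopology)

lemma Hw_continuous:
  "f \<in> Hw \<Longrightarrow> bounded B \<Longrightarrow> continuous_map (subtopology weak_star_topology B) euclideanreal f"
  by (simp add: Hw_def)

lemma delta_in_Hw: "delta x \<in> Hw"
  unfolding delta_def
  by (rule HwI) (simp_all add: scaleR_blinfun.rep_eq strong_operator_topology_continuous_evaluation)

lemma Hw_linear_subspace: "linear_subspace (Hw :: 'x::banach dual_fun set)"
  unfolding linear_subspace_def
proof (intro conjI ballI allI)
  fix f g :: "'x dual_fun" and c :: real
  assume f: "f \<in> Hw"
  show "(\<lambda>t. c * f t) \<in> Hw"
    using f by (auto simp: Hw_def intro: continuous_map_real_mult_left)
  assume g: "g \<in> Hw"
  show "(\<lambda>t. f t + g t) \<in> Hw"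
    using f g by (auto simp: Hw_def distrib_left intro: continuous_map_add)
qed (simp add: Hw_def)

lemma vector_sublattice_Hw: "vector_sublattice Hw (Hw :: 'x::banach dual_fun set)"
  unfolding vector_sublattice_def
proof (intro conjI ballI Hw_linear_subspace order_refl)
  fix f g :: "'x dual_fun"
  assume fg: "f \<in> Hw" "g \<in> Hw"
  show "sup f g \<in> Hw"
    using fg by (auto simp: Hw_def sup_fun_def sup_max max_mult_distrib_left
        intro: continuous_map_real_max)
  show "inf f g \<in> Hw"
    using fg by (auto simp: Hw_def inf_fun_def inf_min min_mult_distrib_left
        intro: continuous_map_real_min)
qed

lemma vector_sublattice_Inter:
  assumes "\<V> \<noteq> {}" "\<And>V. V \<in> \<V> \<Longrightarrow> vector_sublattice H V"
  shows "vector_sublattice H (\<Inter>\<V>)"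
  using assms unfolding vector_sublattice_def linear_subspace_def by fastforce

text \<open>\<open>H\<close> itself belongs to the family being intersected, so this family is
  nonempty.\<close>

lemma vector_sublattice_hull:
  assumes "A \<subseteq> H" "vector_sublattice H H"
  shows "vector_sublattice H (vector_sublattice H hull A)"
  unfolding hull_def by (rule vector_sublattice_Inter) (use assms in auto)

lemma vector_sublattice_FVL: "vector_sublattice Hw FVL"
  unfolding FVL_def
  by (rule vector_sublattice_hull) (auto simp: delta_in_Hw vector_sublattice_Hw)

lemma
  shows FVL_subset_Hw: "FVL \<subseteq> Hw"
    and FVL_zero: "(\<lambda>_. 0) \<in> FVL"
    and FVL_scale: "f \<in> FVL \<Longrightarrow> (\<lambda>t. c * f t) \<in> FVL"
    and FVL_sup: "f \<in> FVL \<Longrightarrow> g \<in> FVL \<Longrightarrow> sup f g \<in> FVL"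
    and FVL_inf: "f \<in> FVL \<Longrightarrow> g \<in> FVL \<Longrightarrow> inf f g \<in> FVL"
  using vector_sublattice_FVL unfolding vector_sublattice_def linear_subspace_def by blast+

lemma FVL_abs_delta: "(\<lambda>t. \<bar>delta x t\<bar>) \<in> FVL"
proof -
  have "delta x \<in> FVL"
    unfolding FVL_def by (simp add: hull_inc)
  from FVL_sup[OF this FVL_scale[OF this, of "- 1"]]
  have "sup (delta x) (\<lambda>t. - 1 * delta x t) \<in> FVL" .
  moreover have "sup (delta x) (\<lambda>t. - 1 * delta x t) = (\<lambda>t. \<bar>delta x t\<bar>)"
    by (auto simp: fun_eq_iff sup_max)
  ultimately show ?thesis
    by simp
qed

text \<open>An ideal containing \<open>delta x\<close> contains \<open>c * delta x\<close> and
  everything in \<open>Hw\<close> dominated by it in absolute value. This places functions below a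
  multiple of \<open>\<bar>delta x t\<bar>\<close> in the ideal without describing the ideal
  completely.\<close>

lemma Iw_dominated:
  assumes "f \<in> Hw" "\<And>t. \<bar>f t\<bar> \<le> c * \<bar>delta x t\<bar>"
  shows "f \<in> Iw"
  unfolding Iw_def hull_def
proof clarify
  fix V :: "'a dual_fun set"
  assume V: "order_ideal Hw V" "range delta \<subseteq> V"
  then have "delta x \<in> V"
    by auto
  then have "(\<lambda>t. c * delta x t) \<in> V"
    using V(1) by (simp add: order_ideal_def linear_subspace_def)
  moreover have "\<bar>f t\<bar> \<le> \<bar>c * delta x t\<bar>" for t
    using assms(2)[of t] mult_right_mono[OF abs_ge_self[of c] abs_ge_zero[of "delta x t"]]
    by (simp add: abs_mult)
  ultimately show "f \<in> V"
    using V(1) assms(1) unfolding order_ideal_def by meson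
qed

text \<open>A basic open set for pointwise convergence restricts only finitely many coordinates, so
  weak-star continuity on a bounded set becomes control by finitely many vectors with one common
  tolerance.\<close>

lemma Hw_neighbourhood:
  fixes f :: "'x::banach dual_fun"
  assumes f: "f \<in> Hw" and B: "bounded B" "x0 \<in> B" and e: "e > 0"
  obtains F \<eta> where "finite F" "\<eta> > 0"
    "\<And>x'. x' \<in> B \<Longrightarrow> (\<And>y. y \<in> F \<Longrightarrow> \<bar>blinfun_apply x' y - blinfun_apply x0 y\<bar> < \<eta>) \<Longrightarrow>
      \<bar>f x' - f x0\<bar> < e"
proof -
  have "openin (subtopology weak_star_topology B)
      {x' \<in> topspace (subtopology weak_star_topology B). f x' \<in> ball (f x0) e}"
    using Hw_continuous[OF f B(1)] by (rule openin_continuous_map_preimage) simp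
  then obtain W where W: "openin weak_star_topology W"
    and WB: "{x' \<in> topspace (subtopology weak_star_topology B). f x' \<in> ball (f x0) e} = W \<inter> B"
    by (auto simp: openin_subtopology)
  then have WB': "x' \<in> W \<longleftrightarrow> \<bar>f x' - f x0\<bar> < e" if "x' \<in> B" for x'
    using that by (auto simp: set_eq_iff strong_operator_topology_topspace dist_real_def abs_minus_commute)
  obtain U :: "('x \<Rightarrow> real) set" where U: "open U" "W = blinfun_apply -` U"
    using W by (auto simp: strong_operator_topology_def openin_pullback_topology)
  have "blinfun_apply x0 \<in> U"
    using WB'[OF B(2)] e U(2) by auto
  moreover have "openin (product_topology (\<lambda>_. euclidean) UNIV) U"
    using U(1) by (simp add: euclidean_product_topology)
  ultimately obtain V where V: "blinfun_apply x0 \<in> (\<Pi>\<^sub>E y\<in>UNIV. V y)" "\<And>y. open (V y)"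
      "finite {y. V y \<noteq> UNIV}" "(\<Pi>\<^sub>E y\<in>UNIV. V y) \<subseteq> U"
    using product_topology_open_contains_basis[of "\<lambda>_. euclidean" UNIV U "blinfun_apply x0"] by auto
  define F where "F = {y. V y \<noteq> UNIV}"
  have "\<exists>\<eta>>0. ball (blinfun_apply x0 y) \<eta> \<subseteq> V y" for y
    using V(1,2) by (meson PiE_mem UNIV_I openE)
  then obtain \<eta> where \<eta>: "\<And>y. \<eta> y > 0" "\<And>y. ball (blinfun_apply x0 y) (\<eta> y) \<subseteq> V y"
    by metis
  \<comment> \<open>The inserted 1 provides a positive tolerance when \<open>F\<close> is
    empty.\<close>
  define r where "r = Min (insert 1 (\<eta> ` F))"
  have r: "r > 0" "\<And>y. y \<in> F \<Longrightarrow> r \<le> \<eta> y"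
    using V(3) \<eta>(1) by (auto simp: r_def F_def)
  show ?thesis
  proof (rule that)
    show "finite F"
      using V(3) by (simp add: F_def)
    show "r > 0"
      by (fact r)
    fix x' assume x': "x' \<in> B"
      and close: "\<And>y. y \<in> F \<Longrightarrow> \<bar>blinfun_apply x' y - blinfun_apply x0 y\<bar> < r"
    have "blinfun_apply x' y \<in> V y" for y
    proof (cases "y \<in> F")
      case True
      then have "blinfun_apply x' y \<in> ball (blinfun_apply x0 y) (\<eta> y)"
        using close[OF True] r(2)[OF True] by (simp add: dist_real_def abs_minus_commute)
      then show ?thesis
        using \<eta>(2) by blast
    qed (simp add: F_def)
    then have "blinfun_apply x' \<in> U"
      using V(4) by auto
    then show "\<bar>f x' - f x0\<bar> < e"
      using WB'[OF x'] U(2) by simp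
  qed
qed

text \<open>Since \<open>T\<close> is not compact, every \<open>x0\<close> is the weak-star limit of a bounded net along which
  \<open>\<parallel>T\<^sup>* x'\<parallel>\<close> exceeds \<open>f\<close>; the hypothesis says nothing more than \<open>f \<le> u\<close> there.\<close>

lemma Hw_le_of_min_adjoint_le:
  fixes T :: "'z::real_normed_vector \<Rightarrow>\<^sub>L 'x::banach"
  assumes T: "\<not> compact_operator T" and f: "f \<in> Hw" and u: "u \<in> Hw"
    and le: "\<And>x'. min (f x') (norm (dual_operator T x')) \<le> u x'"
  shows "f \<le> u"
proof (rule le_funI, rule ccontr)
  fix x0
  assume "\<not> f x0 \<le> u x0"
  \<comment> \<open>Half the gap keeps \<open>u\<close> below \<open>f\<close> near
    \<open>x0\<close>; the cap 1 keeps \<open>f\<close> below \<open>\<bar>f x0\<bar> + 1\<close>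
    there.\<close>
  define e where "e = min 1 ((f x0 - u x0) / 2)"
  have e: "e > 0" "e \<le> 1" "2 * e \<le> f x0 - u x0"
    using \<open>\<not> f x0 \<le> u x0\<close> by (simp_all add: e_def min_def)
  obtain \<delta> where \<delta>: "\<delta> > 0" and null: "\<And>F \<epsilon>. finite F \<Longrightarrow> \<epsilon> > 0 \<Longrightarrow>
      \<exists>x'. norm x' \<le> 1 \<and> (\<forall>y\<in>F. \<bar>blinfun_apply x' y\<bar> \<le> \<epsilon>) \<and> \<delta> \<le> norm (dual_operator T x')"
    using noncompact_operator_adjoint_not_weak_star_null[OF T] by blast
  \<comment> \<open>If the adjoint has norm at least \<open>\<delta>\<close> at \<open>x1\<close>,
    then at \<open>x0 + t *\<^sub>R x1\<close> its norm is at least \<open>t * \<delta>\<close>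
    minus the norm at \<open>x0\<close>, which is \<open>\<bar>f x0\<bar> + 1\<close>.\<close>
  define t where "t = (norm (dual_operator T x0) + \<bar>f x0\<bar> + 1) / \<delta>"
  have t: "t > 0" and t\<delta>: "t * \<delta> = norm (dual_operator T x0) + \<bar>f x0\<bar> + 1"
    using \<delta> by (auto simp: t_def intro!: divide_pos_pos add_nonneg_pos add_nonneg_nonneg)
  let ?B = "cball 0 (norm x0 + t) :: ('x \<Rightarrow>\<^sub>L real) set"
  have x0: "x0 \<in> ?B"
    using t by simp
  obtain F \<eta> where F: "finite F" "\<eta> > 0" and Fc: "\<And>x'. x' \<in> ?B \<Longrightarrow>
      (\<And>y. y \<in> F \<Longrightarrow> \<bar>blinfun_apply x' y - blinfun_apply x0 y\<bar> < \<eta>) \<Longrightarrow> \<bar>f x' - f x0\<bar> < e"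
    using Hw_neighbourhood[OF f bounded_cball x0 e(1)] by blast
  obtain G \<theta> where G: "finite G" "\<theta> > 0" and Gc: "\<And>x'. x' \<in> ?B \<Longrightarrow>
      (\<And>y. y \<in> G \<Longrightarrow> \<bar>blinfun_apply x' y - blinfun_apply x0 y\<bar> < \<theta>) \<Longrightarrow> \<bar>u x' - u x0\<bar> < e"
    using Hw_neighbourhood[OF u bounded_cball x0 e(1)] by blast
  \<comment> \<open>Moving by \<open>t *\<^sub>R x1\<close> then changes the values on
    \<open>F\<close> and \<open>G\<close> by at most half of the smaller tolerance.\<close>
  define r where "r = min \<eta> \<theta> / (2 * t)"
  have r: "r > 0"
    using F(2) G(2) t by (simp add: r_def)
  obtain x1 where x1: "norm x1 \<le> 1" "\<And>y. y \<in> F \<union> G \<Longrightarrow> \<bar>blinfun_apply x1 y\<bar> \<le> r"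
      "\<delta> \<le> norm (dual_operator T x1)"
    using null[of "F \<union> G" r] F(1) G(1) r by blast
  define x' where "x' = x0 + t *\<^sub>R x1"
  have "norm (t *\<^sub>R x1) \<le> t"
    using x1(1) t by (simp add: mult_left_le)
  then have B: "x' \<in> ?B"
    unfolding x'_def using norm_triangle_ineq[of x0 "t *\<^sub>R x1"] by simp
  have close: "\<bar>blinfun_apply x' y - blinfun_apply x0 y\<bar> < min \<eta> \<theta>" if "y \<in> F \<union> G" for y
  proof -
    have "\<bar>blinfun_apply x' y - blinfun_apply x0 y\<bar> = t * \<bar>blinfun_apply x1 y\<bar>"
      using t by (simp add: x'_def plus_blinfun.rep_eq scaleR_blinfun.rep_eq abs_mult)
    also have "\<dots> \<le> t * r"
      using x1(2)[OF that] t by simp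
    also have "\<dots> < min \<eta> \<theta>"
      using t F(2) G(2) by (simp add: r_def min_def)
    finally show ?thesis .
  qed
  have "\<bar>f x' - f x0\<bar> < e" "\<bar>u x' - u x0\<bar> < e"
    using close by (intro Fc Gc B; force)+
  then have "u x' < f x'" "f x' < \<bar>f x0\<bar> + 1"
    using e(2,3) by - linarith+
  moreover have "\<bar>f x0\<bar> + 1 \<le> norm (dual_operator T x')"
  proof -
    have "dual_operator T x' = dual_operator T x0 + t *\<^sub>R dual_operator T x1"
      by (simp add: x'_def blinfun.add_right blinfun.scaleR_right)
    then have "t * norm (dual_operator T x1) \<le> norm (dual_operator T x') + norm (dual_operator T x0)"
      using norm_triangle_ineq4[of "dual_operator T x'" "dual_operator T x0"] t by simp
    moreover have "t * \<delta> \<le> t * norm (dual_operator T x1)"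
      using x1(3) t by simp
    ultimately show ?thesis
      using t\<delta> by simp
  qed
  ultimately show False
    using le[of x'] by (simp add: min_def split: if_splits)
qed

section \<open>Norming sets and the Fatou property\<close>

text \<open>By induction on the generators: rational multiples of the new one are added to a
  countable set for the others, and a continuous map sends the closure of a product into the closure
  of its image.\<close>

lemma countable_dense_span:
  fixes B :: "'a::real_normed_vector set"
  assumes "finite B"
  obtains C where "countable C" "span B \<subseteq> closure C"
proof -
  have "\<exists>C. countable C \<and> span B \<subseteq> closure C"
    using assms
  proof (induction B rule: finite_induct)
    case empty
    then show ?case
      by (intro exI[of _ "{0}"]) simp
  next
    case (insert b B)
    then obtain C where C: "countable C" "span B \<subseteq> closure C"
      by blast
    let ?h = "\<lambda>(r, c). r *\<^sub>R b + c"
    have "span (insert b B) \<subseteq> ?h ` (closure (\<rat> \<times> C))"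
    proof
      fix x assume "x \<in> span (insert b B)"
      then obtain k where "x - k *\<^sub>R b \<in> span B"
        by (auto simp: span_insert)
      then have "(k, x - k *\<^sub>R b) \<in> closure (\<rat> \<times> C)"
        using C(2) by (auto simp: closure_Times Rats_closure_real)
      then show "x \<in> ?h ` (closure (\<rat> \<times> C))"
        by (rule rev_image_eqI) simp
    qed
    also have "\<dots> \<subseteq> closure (?h ` (\<rat> \<times> C))"
      unfolding case_prod_beta
      by (intro image_closure_subset closure_subset closed_closure continuous_intros)
    finally show ?case
      using C(1) countable_rat
      by (intro exI[of _ "?h ` (\<rat> \<times> C)"] conjI countable_image countable_SIGMA)
  qed
  with that show ?thesis
    by blast
qed

text \<open>If \<open>r\<close> bounded the functional on the unit ball, then using both signs of a
  normalised vector would bound its absolute value, hence its norm, by \<open>r\<close>.\<close>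

lemma norm_blinfun_less_imp:
  fixes \<phi> :: "'z::real_normed_vector \<Rightarrow>\<^sub>L real"
  assumes "r < norm \<phi>"
  obtains d where "norm d \<le> 1" "r < blinfun_apply \<phi> d"
proof (rule ccontr)
  assume "\<not> thesis"
  with that have le: "\<phi> d \<le> r" if "norm d \<le> 1" for d
    using \<open>norm d \<le> 1\<close> not_le by blast
  have "norm \<phi> \<le> r"
  proof (rule norm_blinfun_bound)
    show "0 \<le> r"
      using le[of 0] by simp
    show "norm (\<phi> x) \<le> r * norm x" for x
    proof (cases "x = 0")
      case False
      have "\<phi> (s *\<^sub>R (x /\<^sub>R norm x)) \<le> r" if "\<bar>s\<bar> = 1" for s
        using that False by (intro le) (simp add: abs_mult)
      from this[of 1] this[of "- 1"] False show ?thesis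
        by (simp add: blinfun.scaleR_right blinfun.minus_right field_simps abs_le_iff)
    qed simp
  qed
  with assms show False
    by simp
qed

lemma SFDR_countable_norming:
  fixes T :: "'z::banach \<Rightarrow>\<^sub>L 'x::banach"
  assumes "SFDR T Z"
  obtains d :: "nat \<Rightarrow> 'z" where "\<And>j. norm (d j) \<le> 1"
    "\<And>r x'. r < norm (dual_operator T x') \<Longrightarrow> \<exists>j. r < dual_operator T x' (d j)"
proof -
  have "\<exists>C. countable C \<and> Z k \<subseteq> closure C" for k
    using assms countable_dense_span unfolding SFDR_def by metis
  then obtain C where C: "\<And>k. countable (C k)" "\<And>k. Z k \<subseteq> closure (C k)"
    by metis
  \<comment> \<open>The points of \<open>C k\<close> may lie outside the unit ball. This radial
    retraction moves them into it and fixes the ball pointwise.\<close>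
  define \<pi> :: "'z \<Rightarrow> 'z" where "\<pi> c = c /\<^sub>R max 1 (norm c)" for c
  have \<pi>_norm: "norm (\<pi> c) \<le> 1" for c
    by (auto simp: \<pi>_def max_def field_simps)
  have \<pi>_cont: "continuous_on UNIV \<pi>"
    unfolding \<pi>_def by (intro continuous_intros) (auto simp: max_def)
  define D where "D = \<pi> ` (insert 0 (\<Union>k. C k))"
  have D: "countable D" "D \<noteq> {}"
    using C(1) by (auto simp: D_def)
  have norming: "\<exists>c\<in>D. r < dual_operator T x' c" if r: "r < norm (dual_operator T x')" for r x'
  proof -
    let ?g = "blinfun_apply (dual_operator T x')"
    have "r < (SUP k. SUP z\<in>{z \<in> Z k. norm z \<le> 1}. ?g z)"
      using assms r unfolding SFDR_def by metis
    then obtain k where "r < (SUP z\<in>{z \<in> Z k. norm z \<le> 1}. ?g z)"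
      by (rule less_cSupE) auto
    moreover have "0 \<in> Z k"
      using assms by (auto simp: SFDR_def subspace_0)
    ultimately obtain z where z: "z \<in> Z k" "norm z \<le> 1" "r < ?g z"
      by (elim less_cSupE) force+
    \<comment> \<open>Composition with \<open>\<pi>\<close> makes the strict inequality an open
      condition on the whole space. It holds at \<open>z\<close>, because \<open>\<pi>\<close> fixes
      \<open>z\<close>, and therefore at some point of \<open>C k\<close>.\<close>
    have "continuous_on UNIV (\<lambda>c. ?g (\<pi> c))"
      by (intro continuous_intros \<pi>_cont)
    then have "open {c. r < ?g (\<pi> c)}"
      by (rule open_Collect_less[OF continuous_on_const])
    moreover have "z \<in> {c. r < ?g (\<pi> c)}"
      using z by (simp add: \<pi>_def max_def)
    moreover have "z \<in> closure (C k)"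
      using z(1) C(2) by blast
    ultimately obtain c where "c \<in> C k" "r < ?g (\<pi> c)"
      by (auto simp: closure_iff_nhds_not_empty)
    then show ?thesis
      by (auto simp: D_def)
  qed
  show ?thesis
  proof (rule that)
    show "norm (from_nat_into D j) \<le> 1" for j
      using from_nat_into[OF D(2), of j] \<pi>_norm by (auto simp: D_def)
    show "\<exists>j. r < dual_operator T x' (from_nat_into D j)" if "r < norm (dual_operator T x')" for r x'
      using norming[OF that] D by (metis from_nat_into_surj)
  qed
qed

text \<open>Running suprema of \<open>m\<close> stay in \<open>S\<close>. Dominating each
  \<open>m j\<close> is all that identifying the supremum of the sequence will require.\<close>

lemma incseq_of_sup_closed:
  fixes m :: "nat \<Rightarrow> 'a::semilattice_sup"
  assumes "\<And>j. m j \<in> S" "\<And>a b. a \<in> S \<Longrightarrow> b \<in> S \<Longrightarrow> sup a b \<in> S"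
  obtains s where "incseq s" "range s \<subseteq> S" "\<And>j. m j \<le> s j"
proof -
  define s where "s = rec_nat (m 0) (\<lambda>k h. sup h (m (Suc k)))"
  have s: "s 0 = m 0" "s (Suc k) = sup (s k) (m (Suc k))" for k
    by (simp_all add: s_def)
  have "incseq s"
    by (rule incseq_SucI) (simp add: s)
  moreover have "s j \<in> S" for j
    by (induction j) (auto simp: s assms)
  moreover have "m j \<le> s j" for j
    by (cases j) (simp_all add: s)
  ultimately show ?thesis
    using that by blast
qed

text \<open>Domination by the norm of the adjoint bounds all members of \<open>S\<close> by one
  summing constant, while \<open>f\<close> may be scaled up at will after \<open>c\<close> is given.
  Everything lies in both \<open>FVL\<close> and \<open>Iw\<close> with finite norm, so the same
  family serves all three lattices.\<close>

lemma bounded_sup_closed_family_below_large_function: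
  fixes T :: "'z::banach \<Rightarrow>\<^sub>L 'x::banach" and c :: real
  assumes p: "1 \<le> p" and T: "\<not> compact_operator T" and sm: "p_summing p (dual_operator T)"
  obtains S and f :: "'x dual_fun" where
    "S \<noteq> {}" "f \<in> FVL" "f \<in> Iw" "hnorm p f < \<infinity>"
    "\<forall>h\<in>S. h \<in> FVL \<and> h \<in> Iw \<and> hnorm p h < \<infinity> \<and> (\<lambda>_. 0) \<le> h \<and> h \<le> f"
    "\<forall>h\<in>S. \<forall>k\<in>S. sup h k \<in> S"
    "\<forall>d. norm d \<le> 1 \<longrightarrow> inf f (\<lambda>x'. \<bar>dual_operator T x' d\<bar>) \<in> S"
    "ennreal c * (SUP h\<in>S. hnorm p h) < hnorm p f"
proof -
  let ?g = "\<lambda>x'. norm (dual_operator T x')"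
  obtain C where C: "C \<ge> 0" "\<And>n v. lp_norm p n (\<lambda>i. ?g (v i)) \<le> C * weak_norm p n v"
    using p_summingE[OF sm] by blast
  have hn: "hnorm p h \<le> ennreal (k * C)" if "k \<ge> 0" "\<And>x'. \<bar>h x'\<bar> \<le> k * ?g x'" for h k
  proof (rule hnorm_le)
    show "0 \<le> k * C"
      using that C by simp
    fix n and v :: "nat \<Rightarrow> ('x \<Rightarrow>\<^sub>L real)"
    have "lp_norm p n (\<lambda>i. h (v i)) \<le> lp_norm p n (\<lambda>i. k * ?g (v i))"
      using that by (intro lp_norm_mono) (auto simp: abs_mult)
    also have "\<dots> = k * lp_norm p n (\<lambda>i. ?g (v i))"
      using lp_norm_scale[OF p that(1)] .
    also have "\<dots> \<le> k * (C * weak_norm p n v)"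
      using C(2) that(1) by (intro mult_left_mono)
    finally show "lp_norm p n (\<lambda>i. h (v i)) \<le> k * C * weak_norm p n v"
      by (simp add: mult.assoc)
  qed
  \<comment> \<open>With the empty set of test vectors, non-compactness already yields a functional
    on which the adjoint does not vanish.\<close>
  obtain x0 where "dual_operator T x0 \<noteq> 0"
    using noncompact_operator_adjoint_not_weak_star_null[OF T]
    by (metis finite.emptyI norm_zero not_le zero_less_one)
  then obtain z where z: "dual_operator T x0 z \<noteq> 0"
    by (metis blinfun_eqI zero_blinfun.rep_eq)
  define \<kappa> where "\<kappa> = \<bar>dual_operator T x0 z\<bar> / (\<bar>weak_norm p 1 (\<lambda>_. x0)\<bar> + 1)"
  have \<kappa>: "\<kappa> > 0"
    using z by (simp add: \<kappa>_def)
  \<comment> \<open>\<open>n * \<kappa>\<close> bounds \<open>hnorm p f\<close> from below and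
    \<open>C\<close> bounds the norms over \<open>S\<close> from above; the summand 1 makes the
    comparison with \<open>\<bar>c\<bar> * C\<close> strict.\<close>
  define n where "n = (\<bar>c\<bar> * C + 1) / \<kappa>"
  have n: "n > 0" "n * \<kappa> = \<bar>c\<bar> * C + 1"
    using \<kappa> C(1) by (auto simp: n_def intro!: divide_pos_pos add_nonneg_pos)
  define f :: "'x dual_fun" where "f = (\<lambda>t. n * \<bar>delta (T z) t\<bar>)"
  have f_eq: "f x' = n * \<bar>dual_operator T x' z\<bar>" for x'
    by (simp add: f_def delta_def dual_operator.rep_eq)
  have f0: "0 \<le> f x'" for x'
    using n by (simp add: f_eq)
  have fF: "f \<in> FVL"
    unfolding f_def by (intro FVL_scale FVL_abs_delta)
  define S where "S = {h \<in> FVL. (\<lambda>_. 0) \<le> h \<and> h \<le> f \<and> h \<le> ?g}"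
  have "hnorm p f \<le> ennreal ((n * norm z) * C)"
  proof (rule hn)
    show "\<bar>f x'\<bar> \<le> n * norm z * ?g x'" for x'
      using norm_blinfun[of "dual_operator T x'" z] n(1) by (simp add: f_eq abs_mult mult.commute)
  qed (use n in simp)
  then have f_fin: "hnorm p f < \<infinity>"
    by (rule order_le_less_trans) simp
  have Iw_le_f: "h \<in> Iw" if "h \<in> FVL" "(\<lambda>_. 0) \<le> h" "h \<le> f" for h
    using that FVL_subset_Hw by (intro Iw_dominated[of _ n "T z"]) (auto simp: le_fun_def f_def)
  have hS: "hnorm p h \<le> ennreal C" if "h \<in> S" for h
    using hn[of 1 h] that by (auto simp: S_def le_fun_def)
  have "ennreal c * (SUP h\<in>S. hnorm p h) \<le> ennreal \<bar>c\<bar> * ennreal C"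
    using hS by (intro mult_mono SUP_least ennreal_leI) auto
  also have "\<dots> < ennreal (n * \<kappa>)"
    using C(1) n(2) by (simp add: ennreal_mult'[symmetric] ennreal_less_iff)
  also have "\<dots> \<le> hnorm p f"
    using hnorm_ge[OF p, of f x0] n(1) by (simp add: \<kappa>_def f_eq abs_mult)
  finally have big: "ennreal c * (SUP h\<in>S. hnorm p h) < hnorm p f" .
  show ?thesis
  proof (rule that[of S f])
    show "S \<noteq> {}"
      using FVL_zero f0 by (auto simp: S_def le_fun_def intro!: exI[of _ "\<lambda>_. 0"])
    show "f \<in> Iw"
      using fF f0 by (intro Iw_le_f) (auto simp: le_fun_def)
    show "\<forall>h\<in>S. h \<in> FVL \<and> h \<in> Iw \<and> hnorm p h < \<infinity> \<and> (\<lambda>_. 0) \<le> h \<and> h \<le> f"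
    proof
      fix h assume "h \<in> S"
      then show "h \<in> FVL \<and> h \<in> Iw \<and> hnorm p h < \<infinity> \<and> (\<lambda>_. 0) \<le> h \<and> h \<le> f"
        using Iw_le_f order_le_less_trans[OF hS] by (auto simp: S_def)
    qed
    show "\<forall>h\<in>S. \<forall>k\<in>S. sup h k \<in> S"
      by (auto simp: S_def FVL_sup intro: le_supI1)
    show "\<forall>d. norm d \<le> 1 \<longrightarrow> inf f (\<lambda>x'. \<bar>dual_operator T x' d\<bar>) \<in> S"
    proof (intro allI impI)
      fix d :: 'z assume d: "norm d \<le> 1"
      have "(\<lambda>x'. \<bar>dual_operator T x' d\<bar>) \<in> FVL"
        using FVL_abs_delta[of "T d"] by (simp add: delta_def dual_operator.rep_eq)
      then have "inf f (\<lambda>x'. \<bar>dual_operator T x' d\<bar>) \<in> FVL"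
        using fF FVL_inf by blast
      moreover have "\<bar>dual_operator T x' d\<bar> \<le> ?g x'" for x'
        using norm_blinfun[of "dual_operator T x'" d] mult_left_le[OF d, of "?g x'"] by simp
      ultimately show "inf f (\<lambda>x'. \<bar>dual_operator T x' d\<bar>) \<in> S"
        using f0 by (auto simp: S_def le_fun_def intro: le_infI2)
    qed
  qed (fact fF f_fin big)+
qed

theorem theorem5p2:
  fixes p :: ennreal and T :: "'z::banach \<Rightarrow>\<^sub>L 'x::banach"
  assumes "1 \<le> p"
    and "\<not> compact_operator T"
    and "p_summing p (dual_operator T)"
  shows "(\<forall>L \<in> {FBL p, Iwp p, Hwp p :: 'x dual_fun set}.
            \<forall>c>0. \<not> fatou_property c L (hnorm p)) \<and>
         ((\<exists>Z. SFDR T Z) \<longrightarrow>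
          (\<forall>L \<in> {FBL p, Iwp p, Hwp p :: 'x dual_fun set}.
            \<forall>c>0. \<not> countable_fatou_property c L (hnorm p)))"
proof -
  have mem: "h \<in> L" if L: "L \<in> {FBL p, Iwp p, Hwp p :: 'x dual_fun set}"
    and h: "h \<in> FVL" "h \<in> Iw" "hnorm p h < \<infinity>" for L h
  proof -
    have "h \<in> Hwp p"
      using h FVL_subset_Hw by (auto simp: Hwp_def)
    with L h assms(1) show ?thesis
      by (auto simp: FBL_def Iwp_def intro: mem_hclosure)
  qed
  have sub: "L \<subseteq> Hw" if "L \<in> {FBL p, Iwp p, Hwp p :: 'x dual_fun set}" for L
    using that by (auto simp: FBL_def Iwp_def hclosure_def Hwp_def)
  \<comment> \<open>\<open>D\<close> asks only for members of \<open>S\<close> above suitable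
    truncations of \<open>f\<close>, a form that fits both the directed family and a sequence of
    running suprema. Upper bounds in any of the three lattices lie in \<open>Hw\<close>, where the
    comparison with \<open>f\<close> takes place.\<close>
  have supremum: "is_supremum_in L S f"
    if L: "L \<in> {FBL p, Iwp p, Hwp p :: 'x dual_fun set}"
      and f: "f \<in> FVL" "f \<in> L" and le: "\<And>h. h \<in> S \<Longrightarrow> h \<le> f"
      and D: "\<And>r x'. r < norm (dual_operator T x') \<Longrightarrow>
        \<exists>d. r < dual_operator T x' d \<and> (\<exists>h\<in>S. inf f (\<lambda>x'. \<bar>dual_operator T x' d\<bar>) \<le> h)"
    for L S f
    unfolding is_supremum_in_def
  proof (intro conjI ballI impI f le)
    fix u assume u: "u \<in> L" "\<forall>h\<in>S. h \<le> u"
    show "f \<le> u"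
    proof (rule Hw_le_of_min_adjoint_le[OF assms(2)])
      show "f \<in> Hw" "u \<in> Hw"
        using f(2) u(1) sub[OF L] by auto
      fix x'
      show "min (f x') (norm (dual_operator T x')) \<le> u x'"
      proof (rule ccontr)
        assume "\<not> ?thesis"
        then have less: "u x' < f x'" "u x' < norm (dual_operator T x')"
          by auto
        obtain d h where d: "u x' < dual_operator T x' d"
          and h: "h \<in> S" "inf f (\<lambda>x'. \<bar>dual_operator T x' d\<bar>) \<le> h"
          using D[OF less(2)] by blast
        have "inf f (\<lambda>x'. \<bar>dual_operator T x' d\<bar>) \<le> u"
          using h u(2) by (blast intro: order_trans)
        from le_funD[OF this, of x'] d less(1) show False
          by (auto simp: inf_min min_def split: if_splits)
      qed
    qed
  qed
  have "\<not> fatou_property c L (hnorm p) \<and> ((\<exists>Z. SFDR T Z) \<longrightarrow> \<not> countable_fatou_property c L (hnorm p))"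
    if L: "L \<in> {FBL p, Iwp p, Hwp p :: 'x dual_fun set}" for L and c :: real
  proof -
    obtain S and f :: "'x dual_fun" where S: "S \<noteq> {}" "f \<in> FVL" "f \<in> Iw" "hnorm p f < \<infinity>"
      "\<forall>h\<in>S. h \<in> FVL \<and> h \<in> Iw \<and> hnorm p h < \<infinity> \<and> (\<lambda>_. 0) \<le> h \<and> h \<le> f"
      "\<forall>h\<in>S. \<forall>k\<in>S. sup h k \<in> S"
      "\<forall>d. norm d \<le> 1 \<longrightarrow> inf f (\<lambda>x'. \<bar>dual_operator T x' d\<bar>) \<in> S"
      "ennreal c * (SUP h\<in>S. hnorm p h) < hnorm p f"
      by (rule bounded_sup_closed_family_below_large_function[OF assms, of c])
    have fL: "f \<in> L"
      using S mem[OF L] by blast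
    have pos: "S \<subseteq> positive_cone L"
      using S(5) mem[OF L] by (auto simp: positive_cone_def)
    have "is_supremum_in L S f"
    proof (rule supremum[OF L S(2) fL])
      fix r x' assume "r < norm (dual_operator T x')"
      then obtain d where "norm d \<le> 1" "r < dual_operator T x' d"
        by (rule norm_blinfun_less_imp)
      then show "\<exists>d. r < dual_operator T x' d \<and> (\<exists>h\<in>S. inf f (\<lambda>x'. \<bar>dual_operator T x' d\<bar>) \<le> h)"
        using S(7) by blast
    qed (use S(5) in blast)
    moreover have "upward_directed S"
      unfolding upward_directed_def using S(1,6) by (blast intro: sup.cobounded1 sup.cobounded2)
    ultimately have "\<not> fatou_property c L (hnorm p)"
      unfolding fatou_property_def using pos S(8) by (meson not_le)
    moreover have "\<not> countable_fatou_property c L (hnorm p)" if "SFDR T Z" for Z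
    proof -
      obtain d :: "nat \<Rightarrow> 'z" where d: "\<And>j. norm (d j) \<le> 1"
        "\<And>r x'. r < norm (dual_operator T x') \<Longrightarrow> \<exists>j. r < dual_operator T x' (d j)"
        using SFDR_countable_norming[OF \<open>SFDR T Z\<close>] by blast
      obtain s where s: "incseq s" "range s \<subseteq> S"
        "\<And>j. inf f (\<lambda>x'. \<bar>dual_operator T x' (d j)\<bar>) \<le> s j"
        using incseq_of_sup_closed[of "\<lambda>j. inf f (\<lambda>x'. \<bar>dual_operator T x' (d j)\<bar>)" S] S(6,7) d(1)
        by blast
      \<comment> \<open>The truncation belonging to \<open>d j\<close> lies below
        \<open>s j\<close>, so the countable norming set supplies \<open>D\<close> along the
        sequence.\<close>
      have "is_supremum_in L (range s) f"
        using d(2) s(2,3) S(5) by (intro supremum[OF L S(2) fL]) blast+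
      moreover have "ennreal c * (SUP n. hnorm p (s n)) \<le> ennreal c * (SUP h\<in>S. hnorm p h)"
        using s(2) by (intro mult_left_mono SUP_least SUP_upper) auto
      ultimately show ?thesis
        unfolding countable_fatou_property_def using s(1,2) pos S(8)
        by (meson leD order_trans order_le_less_trans)
    qed
    ultimately show ?thesis
      by blast
  qed
  then show ?thesis
    by blast
qed

end
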